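(* Let $(K,d)$ be a compact metric space. Let $f:K\to\mathbb{R}$ be continuous with a unique maximizer $t_0\in K$. Then: (a) (Deterministic stability) For every $\varepsilon>0$ there exists $\delta(\varepsilon)>0$ such that $$\sup_{t\in K:\ d(t,t_0)\ge\varepsilon} f(t)\le f(t_0)-\delta(\varepsilon).$$ Consequently, if $g:K\to\mathbb{R}$ satisfies $\|g-f\|_\infty\le\delta(\varepsilon)/3$, then every maximizer $\hat t\in\arg\max_{t\in K}g(t)$ satisfies $d(\hat t,t_0)<\varepsilon$. (b) (Uniform convergence) Let $f_n:K\to\mathbb{R}$ be (possibly random) functions with $\|f_n-f\|_\infty\to 0$ in probability, and let $\hat t_n$ be any approximate maximizer in the sense that $f_n(\hat t_n)\ge\sup_{t\in K}f_n(t)-o_p(1)$. Then $\hat t_n\to t_0$ in probability. (c) (Weak convergence) Suppose $f_n$ are random elements of $C(K)$ and $f_n\Rightarrow f$ in $C(K)$ equipped with the sup norm, where $f$ is a random element of $C(K)$ that almost surely has a unique maximizer $t_0$ (a random element of $K$). Then any measurable choice $\hat t_n\in\arg\max_{t\in K}f_n(t)$ satisfies $\hat t_n\Rightarrow t_0$.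
   Context: $\|\cdot\|_\infty$ is the sup norm on $K$; $C(K)$ is the space of continuous real functions on $K$; $\Rightarrow$ denotes convergence in distribution (weak convergence); $o_p(1)$ denotes a random sequence converging to $0$ in probability. The supremum over the empty set is $-\infty$. *)

theory Defs
  imports "HOL-Probability.Probability"
begin

abbreviation maximizers :: "('a \<Rightarrow> real) \<Rightarrow> 'a set" where
  "maximizers g \<equiv> {t. is_arg_max g (\<lambda>_. True) t}"

text \<open>The sup norm is extended-real valued because it is also taken of functions that need not be
  bounded; a real-valued supremum would be unspecified there.\<close>

definition sup_norm :: "('a \<Rightarrow> real) \<Rightarrow> ereal" where
  "sup_norm g = (SUP t. ereal \<bar>g t\<bar>)"

text \<open>Convergence to \<open>0\<close> in probability, where the \<open>n\<close>-th variable may live on its own probability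
  space \<open>M n\<close>. The variables need not be measurable (the sup norm of an arbitrary random function is
  an example), so the probability of the exceedance event is an outer probability; for measurable
  variables this is the usual notion, see \<open>vanishes_in_prob_measurable\<close> below.\<close>

definition vanishes_in_prob :: "(nat \<Rightarrow> 'w measure) \<Rightarrow> (nat \<Rightarrow> 'w \<Rightarrow> ereal) \<Rightarrow> bool" where
  "vanishes_in_prob M Z \<longleftrightarrow>
     (\<forall>e::real. e > 0 \<longrightarrow>
        (\<lambda>n. outer_measure_of (M n) {\<omega> \<in> space (M n). \<bar>Z n \<omega>\<bar> > ereal e}) \<longlonglongrightarrow> 0)"

definition converges_in_prob ::
    "(nat \<Rightarrow> 'w measure) \<Rightarrow> (nat \<Rightarrow> 'w \<Rightarrow> 'b::metric_space) \<Rightarrow> 'b \<Rightarrow> bool" where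
  "converges_in_prob M X c \<longleftrightarrow> vanishes_in_prob M (\<lambda>n \<omega>. ereal (dist (X n \<omega>) c))"

text \<open>\<open>X n\<close> is defined on \<open>M n\<close> and the limit \<open>Y\<close> on \<open>N\<close>; all of them are meant to be Borel
  measurable. The test functions are the bounded continuous real functions.\<close>

definition converges_in_distribution ::
    "(nat \<Rightarrow> 'w measure) \<Rightarrow> (nat \<Rightarrow> 'w \<Rightarrow> 'b::topological_space) \<Rightarrow>
     'v measure \<Rightarrow> ('v \<Rightarrow> 'b) \<Rightarrow> bool" where
  "converges_in_distribution M X N Y \<longleftrightarrow>
     (\<forall>h :: 'b \<Rightarrow>\<^sub>C real.
        (\<lambda>n. \<integral>\<omega>. apply_bcontfun h (X n \<omega>) \<partial>M n) \<longlonglongrightarrow> (\<integral>\<omega>. apply_bcontfun h (Y \<omega>) \<partial>N))"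

lemma vanishes_in_prob_measurable:
  assumes "\<And>n. prob_space (M n)" and meas: "\<And>n. Z n \<in> borel_measurable (M n)"
  shows "vanishes_in_prob M Z \<longleftrightarrow>
     (\<forall>e::real. e > 0 \<longrightarrow>
        (\<lambda>n. measure (M n) {\<omega> \<in> space (M n). \<bar>Z n \<omega>\<bar> > ereal e}) \<longlonglongrightarrow> 0)"
proof -
  have "outer_measure_of (M n) {\<omega> \<in> space (M n). \<bar>Z n \<omega>\<bar> > ereal e}
      = ennreal (measure (M n) {\<omega> \<in> space (M n). \<bar>Z n \<omega>\<bar> > ereal e})" for n e
  proof -
    interpret prob_space "M n" by fact
    have [measurable]: "Z n \<in> borel_measurable (M n)" by (rule meas)
    have "{\<omega> \<in> space (M n). \<bar>Z n \<omega>\<bar> > ereal e} \<in> sets (M n)" by measurable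
    then show ?thesis by (simp add: emeasure_eq_measure)
  qed
  then show ?thesis
    unfolding vanishes_in_prob_def by (simp add: tendsto_ennreal_iff[where x = 0, simplified])
qed

end

theory Submission
  imports Defs
begin

text \<open>Part (a) is compactness, and part (b) is (a) outside an exceptional event of small outer
  probability. For part (c), let \<open>S g\<close> be the supremum of \<open>g\<close> and, for a test function \<open>h\<close> on \<open>K\<close>
  and \<open>k \<ge> 0\<close>, let \<open>H\<^sub>k g = S (h + k g) - k (S g)\<close>. This is a bounded continuous functional on
  \<open>C(K)\<close> that dominates \<open>h\<close> at every maximizer of \<open>g\<close>, and \<open>H\<^sub>k g\<close> tends to \<open>h t\<^sub>0\<close> as \<open>k \<rightarrow> \<infinity>\<close>
  if \<open>t\<^sub>0\<close> is the only maximizer of \<open>g\<close>. Hence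
  \<open>limsup E h(T\<^sub>n) \<le> lim E H\<^sub>k(F\<^sub>n) = E H\<^sub>k(f)\<close>, and the right-hand side tends to \<open>E h(t\<^sub>0)\<close> by
  dominated convergence. Applied to \<open>h\<close> and \<open>-h\<close>, this gives the convergence of \<open>E h(T\<^sub>n)\<close>.\<close>

section \<open>Maximizers, the sup norm and deterministic stability\<close>

lemma mem_maximizers_iff: "s \<in> maximizers g \<longleftrightarrow> (\<forall>t. g t \<le> g s)"
  by (simp add: is_arg_max_linorder)

lemma maximizers_singletonD:
  assumes "maximizers g = {s}"
  shows "g t \<le> g s"
  using assms mem_maximizers_iff[of s g] by auto

lemma sup_norm_le_iff: "sup_norm g \<le> ereal c \<longleftrightarrow> (\<forall>t. \<bar>g t\<bar> \<le> c)"
  by (simp add: sup_norm_def SUP_le_iff)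

lemma sup_norm_nonneg: "0 \<le> sup_norm g"
  unfolding sup_norm_def by (rule SUP_upper2[of undefined]) auto

text \<open>The points at distance at least \<open>\<epsilon>\<close> from \<open>t0\<close> form a
  compact set, on which \<open>f\<close> attains its maximum at some \<open>s\<close>. Uniqueness
  forces \<open>f s < f t0\<close>, and this gap serves as \<open>\<delta>\<close>.\<close>

lemma well_separated_maximizer:
  fixes f :: "'a::metric_space \<Rightarrow> real"
  assumes comp: "compact (UNIV :: 'a set)" and cont: "continuous_on UNIV f"
    and max: "maximizers f = {t0}" and \<epsilon>: "\<epsilon> > 0"
  obtains \<delta> where "\<delta> > 0" "\<And>t. dist t t0 \<ge> \<epsilon> \<Longrightarrow> f t \<le> f t0 - \<delta>"
proof (cases "{t. dist t t0 \<ge> \<epsilon>} = {}")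
  \<comment> \<open>Without far points the bound is vacuous, and any positive
    \<open>\<delta>\<close> will do.\<close>
  case True
  then show thesis
    using that[of 1] by auto
next
  case False
  have "closed {t. dist t t0 \<ge> \<epsilon>}"
    by (intro closed_Collect_le continuous_intros)
  then have "compact {t. dist t t0 \<ge> \<epsilon>}"
    using compact_Int_closed[OF comp] by simp
  then obtain s where s: "dist s t0 \<ge> \<epsilon>" "\<And>t. dist t t0 \<ge> \<epsilon> \<Longrightarrow> f t \<le> f s"
    using continuous_attains_sup[OF _ False continuous_on_subset[OF cont subset_UNIV]] by auto
  have "s \<notin> maximizers f"
    using s(1) \<epsilon> max by auto
  then have "f s < f t0"
    using maximizers_singletonD[OF max] unfolding mem_maximizers_iff
    by (meson linorder_not_le order_trans)
  then show thesis
    using that[of "f t0 - f s"] s(2) by simp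
qed

text \<open>Passing from \<open>f\<close> to \<open>g\<close> costs at most
  \<open>\<delta> / 3\<close> at each of \<open>s\<close> and \<open>t0\<close>, so a far
  \<open>s\<close> would have \<open>g s \<le> g t0 - \<delta> / 3\<close>. The slack lets the lemma
  serve exact maximizers in (a) and approximate ones in (b).\<close>

lemma near_maximizer_close:
  fixes f g :: "'a::metric_space \<Rightarrow> real"
  assumes sep: "\<And>t. dist t t0 \<ge> \<epsilon> \<Longrightarrow> f t \<le> f t0 - \<delta>"
    and near: "sup_norm (\<lambda>t. g t - f t) \<le> ereal (\<delta> / 3)"
    and s: "g s > g t0 - \<delta> / 3"
  shows "dist s t0 < \<epsilon>"
proof (rule ccontr)
  assume "\<not> dist s t0 < \<epsilon>"
  then have "f s \<le> f t0 - \<delta>"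
    by (intro sep) simp
  moreover have "\<bar>g s - f s\<bar> \<le> \<delta> / 3" "\<bar>g t0 - f t0\<bar> \<le> \<delta> / 3"
    using near by (auto simp: sup_norm_le_iff)
  ultimately show False
    using s by linarith
qed

section \<open>Outer probability and convergence in probability\<close>

lemma outer_measure_of_Un_le:
  assumes "A \<subseteq> space M" "B \<subseteq> space M"
  shows "outer_measure_of M (A \<union> B) \<le> outer_measure_of M A + outer_measure_of M B"
proof -
  \<comment> \<open>Measurable supersets of the same measure reduce the claim to ordinary
    subadditivity.\<close>
  obtain A' where A': "A' \<in> sets M" "A \<subseteq> A'" "outer_measure_of M A = emeasure M A'"
    using outer_measure_of_attain[OF assms(1)] by blast
  obtain B' where B': "B' \<in> sets M" "B \<subseteq> B'" "outer_measure_of M B = emeasure M B'"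
    using outer_measure_of_attain[OF assms(2)] by blast
  have "outer_measure_of M (A \<union> B) \<le> outer_measure_of M (A' \<union> B')"
    using A'(2) B'(2) by (intro outer_measure_of_mono) blast
  also have "\<dots> = emeasure M (A' \<union> B')"
    using A'(1) B'(1) by simp
  also have "\<dots> \<le> emeasure M A' + emeasure M B'"
    using A'(1) B'(1) by (rule emeasure_subadditive)
  finally show ?thesis
    using A'(3) B'(3) by simp
qed

lemma outer_measure_of_AE_not:
  assumes "AE \<omega> in M. P \<omega>"
  shows "outer_measure_of M {\<omega> \<in> space M. \<not> P \<omega>} = 0"
proof -
  obtain N where N: "{\<omega> \<in> space M. \<not> P \<omega>} \<subseteq> N" "emeasure M N = 0" "N \<in> sets M"
    using AE_E[OF assms] .
  have "outer_measure_of M {\<omega> \<in> space M. \<not> P \<omega>} \<le> outer_measure_of M N"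
    by (rule outer_measure_of_mono[OF N(1)])
  then show ?thesis
    using N(2,3) by simp
qed

text \<open>\<open>T n\<close> can be far from \<open>t0\<close> only if the sup-norm error is large
  (\<open>U n\<close>), the slack is large (\<open>V n\<close>) or the almost sure inequality fails
  (\<open>W n\<close>, a null event).\<close>

lemma approx_maximizers_converge_in_prob:
  fixes f :: "'a::metric_space \<Rightarrow> real" and F :: "nat \<Rightarrow> 'w \<Rightarrow> 'a \<Rightarrow> real"
  assumes comp: "compact (UNIV :: 'a set)" and cont: "continuous_on UNIV f"
    and max: "maximizers f = {t0}"
    and unif: "vanishes_in_prob M (\<lambda>n \<omega>. sup_norm (\<lambda>t. F n \<omega> t - f t))"
    and r: "converges_in_prob M r 0"
    and approx: "\<And>n. AE \<omega> in M n. ereal (F n \<omega> (T n \<omega>)) \<ge> (SUP t. ereal (F n \<omega> t)) - ereal (r n \<omega>)"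
  shows "converges_in_prob M T t0"
  unfolding converges_in_prob_def vanishes_in_prob_def
proof (intro allI impI)
  fix e :: real assume "e > 0"
  then obtain \<delta> where \<delta>: "\<delta> > 0" "\<And>t. dist t t0 \<ge> e \<Longrightarrow> f t \<le> f t0 - \<delta>"
    using well_separated_maximizer[OF comp cont max] by blast
  define bad where "bad n = {\<omega> \<in> space (M n). \<bar>ereal (dist (T n \<omega>) t0)\<bar> > ereal e}" for n
  define U where
    "U n = {\<omega> \<in> space (M n). \<bar>sup_norm (\<lambda>t. F n \<omega> t - f t)\<bar> > ereal (\<delta> / 3)}" for n
  \<comment> \<open>Off \<open>V n\<close> only a nonstrict bound on the slack is known;
    \<open>\<delta> / 4\<close> leaves room for the strict inequality with
    \<open>\<delta> / 3\<close> in \<open>near_maximizer_close\<close>.\<close>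
  define V where "V n = {\<omega> \<in> space (M n). \<bar>ereal (dist (r n \<omega>) 0)\<bar> > ereal (\<delta> / 4)}" for n
  define W where "W n = {\<omega> \<in> space (M n).
    \<not> ereal (F n \<omega> (T n \<omega>)) \<ge> (SUP t. ereal (F n \<omega> t)) - ereal (r n \<omega>)}" for n
  have "bad n \<subseteq> U n \<union> V n \<union> W n" for n
  proof
    fix \<omega> assume \<omega>: "\<omega> \<in> bad n"
    show "\<omega> \<in> U n \<union> V n \<union> W n"
    proof (rule ccontr)
      assume "\<omega> \<notin> U n \<union> V n \<union> W n"
      then have near: "sup_norm (\<lambda>t. F n \<omega> t - f t) \<le> ereal (\<delta> / 3)"
        and small: "\<bar>r n \<omega>\<bar> \<le> \<delta> / 4"
        and T: "ereal (F n \<omega> (T n \<omega>)) \<ge> (SUP t. ereal (F n \<omega> t)) - ereal (r n \<omega>)"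
        using \<omega> sup_norm_nonneg[of "\<lambda>t. F n \<omega> t - f t"]
        by (auto simp: bad_def U_def V_def W_def abs_ereal_ge0)
      have "ereal (F n \<omega> t0) - ereal (r n \<omega>) \<le> (SUP t. ereal (F n \<omega> t)) - ereal (r n \<omega>)"
        by (intro ereal_minus_mono SUP_upper) auto
      also note T
      finally have "F n \<omega> (T n \<omega>) > F n \<omega> t0 - \<delta> / 3"
        using small \<delta>(1) by simp
      then have "dist (T n \<omega>) t0 < e"
        using \<delta>(2) near by (intro near_maximizer_close[where f = f and g = "F n \<omega>" and \<delta> = \<delta>]) auto
      then show False
        using \<omega> by (simp add: bad_def)
    qed
  qed
  then have bound: "outer_measure_of (M n) (bad n)
      \<le> outer_measure_of (M n) (U n) + outer_measure_of (M n) (V n)" for n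
  proof -
    have "outer_measure_of (M n) (bad n) \<le> outer_measure_of (M n) (U n \<union> V n \<union> W n)"
      by (rule outer_measure_of_mono) fact
    also have "\<dots> \<le> outer_measure_of (M n) (U n \<union> V n) + outer_measure_of (M n) (W n)"
      by (rule outer_measure_of_Un_le) (auto simp: U_def V_def W_def)
    also have "outer_measure_of (M n) (W n) = 0"
      unfolding W_def by (rule outer_measure_of_AE_not[OF approx])
    also have "outer_measure_of (M n) (U n \<union> V n) + 0
        \<le> outer_measure_of (M n) (U n) + outer_measure_of (M n) (V n)"
      unfolding add_0_right by (rule outer_measure_of_Un_le) (auto simp: U_def V_def)
    finally show ?thesis .
  qed
  have "\<delta> / 3 > 0" "\<delta> / 4 > 0"
    using \<delta>(1) by simp_all
  then have "(\<lambda>n. outer_measure_of (M n) (U n)) \<longlonglongrightarrow> 0" "(\<lambda>n. outer_measure_of (M n) (V n)) \<longlonglongrightarrow> 0"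
    using unif r unfolding converges_in_prob_def vanishes_in_prob_def U_def V_def by blast+
  from tendsto_add[OF this]
  have "(\<lambda>n. outer_measure_of (M n) (U n) + outer_measure_of (M n) (V n)) \<longlonglongrightarrow> 0"
    by simp
  then have "(\<lambda>n. outer_measure_of (M n) (bad n)) \<longlonglongrightarrow> 0"
    by (rule tendsto_sandwich[OF _ _ tendsto_const, rotated 2])
       (auto intro: always_eventually bound)
  then show "(\<lambda>n. outer_measure_of (M n)
      {\<omega> \<in> space (M n). \<bar>ereal (dist (T n \<omega>) t0)\<bar> > ereal e}) \<longlonglongrightarrow> 0"
    unfolding bad_def .
qed

section \<open>The supremum functional and its penalized version\<close>

definition sup_value :: "('a::topological_space \<Rightarrow>\<^sub>C real) \<Rightarrow> real" where
  "sup_value g = (SUP t. apply_bcontfun g t)"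

lemma sup_value_upper: "apply_bcontfun g t \<le> sup_value g"
  unfolding sup_value_def by (intro cSUP_upper bounded_imp_bdd_above) auto

lemma sup_value_least: "(\<And>t. apply_bcontfun g t \<le> c) \<Longrightarrow> sup_value g \<le> c"
  unfolding sup_value_def by (rule cSUP_least) auto

lemma sup_value_maximizer: "s \<in> maximizers (apply_bcontfun g) \<Longrightarrow> sup_value g = apply_bcontfun g s"
  by (intro antisym sup_value_least sup_value_upper) (simp add: is_arg_max_linorder)

text \<open>Used in both directions, this makes \<open>sup_value\<close> 1-Lipschitz; it also yields
  the lower bound in \<open>abs_penalized_sup_le\<close>.\<close>

lemma sup_value_le_add_dist: "sup_value g \<le> sup_value g' + dist g g'"
proof (rule sup_value_least)
  fix t
  show "apply_bcontfun g t \<le> sup_value g' + dist g g'"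
    using dist_bounded[of g t g'] sup_value_upper[of g' t] by (simp add: dist_real_def)
qed

lemma continuous_on_sup_value: "continuous_on A sup_value"
proof (rule lipschitz_on_continuous_on)
  show "1-lipschitz_on A sup_value"
  proof (rule lipschitz_onI)
    fix g g' :: "'a \<Rightarrow>\<^sub>C real"
    show "dist (sup_value g) (sup_value g') \<le> 1 * dist g g'"
      using sup_value_le_add_dist[of g g'] sup_value_le_add_dist[of g' g]
      by (simp add: dist_real_def dist_commute abs_le_iff)
  qed simp
qed

text \<open>This is the supremum of \<open>h + k * (g - sup_value g)\<close>: for
  \<open>k \<ge> 0\<close>, points are penalized for missing the supremum of \<open>g\<close>. In
  the form of a difference, continuity in \<open>g\<close> follows from that of
  \<open>sup_value\<close>.\<close>

definition penalized_sup ::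
    "('a::topological_space \<Rightarrow>\<^sub>C real) \<Rightarrow> real \<Rightarrow> ('a \<Rightarrow>\<^sub>C real) \<Rightarrow> real" where
  "penalized_sup h k g = sup_value (h + k *\<^sub>R g) - k * sup_value g"

lemma continuous_on_penalized_sup: "continuous_on A (penalized_sup h k)"
  unfolding penalized_sup_def
  by (intro continuous_intros continuous_on_sup_value
      continuous_on_compose2[OF continuous_on_sup_value[of UNIV]]) auto

text \<open>The penalty vanishes at a maximizer of \<open>g\<close>.\<close>

lemma penalized_sup_ge:
  assumes "s \<in> maximizers (apply_bcontfun g)"
  shows "apply_bcontfun h s \<le> penalized_sup h k g"
  using sup_value_upper[of "h + k *\<^sub>R g" s]
  by (simp add: penalized_sup_def sup_value_maximizer[OF assms])

lemma penalized_sup_le: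
  assumes "\<And>t. apply_bcontfun h t + k * (apply_bcontfun g t - sup_value g) \<le> c"
  shows "penalized_sup h k g \<le> c"
proof -
  have "sup_value (h + k *\<^sub>R g) \<le> c + k * sup_value g"
    using assms by (intro sup_value_least) (simp add: algebra_simps)
  then show ?thesis
    by (simp add: penalized_sup_def)
qed

text \<open>Above, the penalty is nonpositive. Below, \<open>g\<close> may have no maximizer on a
  general space, so instead of \<open>penalized_sup_ge\<close> the Lipschitz bound is used: adding
  \<open>h\<close> lowers the supremum by at most \<open>norm h\<close>.\<close>

lemma abs_penalized_sup_le:
  assumes "k \<ge> 0"
  shows "\<bar>penalized_sup h k g\<bar> \<le> norm h"
proof -
  have h: "\<bar>apply_bcontfun h t\<bar> \<le> norm h" for t
    using norm_bounded[of h t] by simp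
  have "penalized_sup h k g \<le> norm h"
  proof (rule penalized_sup_le)
    fix t
    have "k * (apply_bcontfun g t - sup_value g) \<le> 0"
      using assms sup_value_upper[of g t] by (simp add: mult_nonneg_nonpos)
    then show "apply_bcontfun h t + k * (apply_bcontfun g t - sup_value g) \<le> norm h"
      using h[of t] by linarith
  qed
  moreover have "- norm h \<le> penalized_sup h k g"
  proof -
    have "sup_value (k *\<^sub>R g) \<le> sup_value (h + k *\<^sub>R g) + norm h"
      using sup_value_le_add_dist[of "k *\<^sub>R g" "h + k *\<^sub>R g"] by (simp add: dist_norm)
    moreover have "k * sup_value g \<le> sup_value (k *\<^sub>R g)"
    \<comment> \<open>The factor is moved out of the supremum by division; for \<open>k = 0\<close>
      the claim is that the zero function has nonnegative supremum.\<close>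
    proof (cases "k = 0")
      case True
      then show ?thesis
        using sup_value_upper[of "0 :: 'a \<Rightarrow>\<^sub>C real" undefined] by simp
    next
      case False
      have "sup_value g \<le> sup_value (k *\<^sub>R g) / k"
      proof (rule sup_value_least)
        fix t
        show "apply_bcontfun g t \<le> sup_value (k *\<^sub>R g) / k"
          using False assms sup_value_upper[of "k *\<^sub>R g" t] by (simp add: field_simps)
      qed
      then show ?thesis
        using False assms by (simp add: field_simps)
    qed
    ultimately show ?thesis
      by (simp add: penalized_sup_def)
  qed
  ultimately show ?thesis
    by linarith
qed

text \<open>The lower bound holds for every \<open>k\<close>, as \<open>t0\<close> is a maximizer.
  For the upper bound, continuity of \<open>h\<close> handles the points near \<open>t0\<close>;
  elsewhere the penalty is at most \<open>- k * \<delta>\<close> and eventually outweighs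
  \<open>h\<close>.\<close>

lemma penalized_sup_tendsto:
  fixes g h :: "'a::metric_space \<Rightarrow>\<^sub>C real"
  assumes comp: "compact (UNIV :: 'a set)" and max: "maximizers (apply_bcontfun g) = {t0}"
  shows "(\<lambda>k. penalized_sup h (real k) g) \<longlonglongrightarrow> apply_bcontfun h t0"
proof (rule order_tendstoI)
  have t0: "t0 \<in> maximizers (apply_bcontfun g)"
    using max by blast
  have sup: "sup_value g = apply_bcontfun g t0"
    by (rule sup_value_maximizer[OF t0])
  show "\<forall>\<^sub>F k in sequentially. a < penalized_sup h (real k) g" if "a < apply_bcontfun h t0" for a
    using order_less_le_trans[OF that penalized_sup_ge[OF t0]] by (intro always_eventually allI)
  fix a assume a: "apply_bcontfun h t0 < a"
  \<comment> \<open>Bounding a supremum gives only \<open>\<le> b\<close>; the midpoint keeps the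
    final inequality with \<open>a\<close> strict.\<close>
  define b where "b = (apply_bcontfun h t0 + a) / 2"
  have b: "apply_bcontfun h t0 < b" "b < a"
    using a by (auto simp: b_def)
  have "continuous_on UNIV (apply_bcontfun h)"
    by simp
  then obtain d where d: "d > 0" "\<And>t. dist t t0 < d \<Longrightarrow>
      dist (apply_bcontfun h t) (apply_bcontfun h t0) < b - apply_bcontfun h t0"
    using b(1) unfolding continuous_on_iff by (meson UNIV_I diff_gt_0_iff_gt)
  obtain \<delta> where \<delta>: "\<delta> > 0" "\<And>t. dist t t0 \<ge> d \<Longrightarrow> apply_bcontfun g t \<le> apply_bcontfun g t0 - \<delta>"
    using well_separated_maximizer[OF comp _ max d(1)] by auto
  \<comment> \<open>From \<open>m\<close> on, the penalty at far points brings even the value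
    \<open>norm h\<close> below \<open>b\<close>.\<close>
  obtain m :: nat where m: "real m * \<delta> > norm h - b"
    using ex_less_of_nat_mult[OF \<delta>(1)] by blast
  have "penalized_sup h (real k) g < a" if "k \<ge> m" for k
  proof -
    have "penalized_sup h (real k) g \<le> b"
    proof (rule penalized_sup_le)
      fix t
      show "apply_bcontfun h t + real k * (apply_bcontfun g t - sup_value g) \<le> b"
      proof (cases "dist t t0 < d")
        case True
        have "real k * (apply_bcontfun g t - sup_value g) \<le> 0"
          using sup_value_upper[of g t] by (simp add: mult_nonneg_nonpos)
        moreover have "apply_bcontfun h t < b"
          using d(2)[OF True] by (simp add: dist_real_def)
        ultimately show ?thesis
          by linarith
      next
        case False
        have "real k * (apply_bcontfun g t - sup_value g) \<le> real k * (- \<delta>)"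
          using \<delta>(2)[of t] False by (intro mult_left_mono) (auto simp: sup)
        moreover have "real m * \<delta> \<le> real k * \<delta>"
          using that \<delta>(1) by simp
        moreover have "apply_bcontfun h t \<le> norm h"
          using norm_bounded[of h t] by simp
        ultimately show ?thesis
          using m by simp
      qed
    qed
    then show ?thesis
      using b(2) by simp
  qed
  then show "\<forall>\<^sub>F k in sequentially. penalized_sup h (real k) g < a"
    unfolding eventually_sequentially by blast
qed

section \<open>Weak convergence of maximizers\<close>

lemma measurable_apply_bcontfun:
  assumes "X \<in> borel_measurable M"
  shows "(\<lambda>\<omega>. apply_bcontfun h (X \<omega>)) \<in> borel_measurable M"
  by (rule borel_measurable_continuous_on[OF _ assms]) simp

lemma (in prob_space) integrable_apply_bcontfun:
  fixes h :: "'b::topological_space \<Rightarrow>\<^sub>C real"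
  assumes "X \<in> borel_measurable M"
  shows "integrable M (\<lambda>\<omega>. apply_bcontfun h (X \<omega>))"
  using norm_bounded[of h]
  by (intro integrable_const_bound[of _ "norm h"] measurable_apply_bcontfun assms) auto

text \<open>Only the upper half is proved here, because \<open>penalized_sup\<close> dominates
  \<open>h\<close> at maximizers; the lower half comes from \<open>- h\<close>.\<close>

lemma argmax_expectation_upper:
  fixes F :: "nat \<Rightarrow> 'w \<Rightarrow> 'a::metric_space \<Rightarrow>\<^sub>C real" and f :: "'v \<Rightarrow> 'a \<Rightarrow>\<^sub>C real"
    and h :: "'a \<Rightarrow>\<^sub>C real"
  assumes comp: "compact (UNIV :: 'a set)"
    and M: "\<And>n. prob_space (M n)" and N: "prob_space N"
    and F: "\<And>n. F n \<in> borel_measurable (M n)" and f: "f \<in> borel_measurable N"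
    and conv: "converges_in_distribution M F N f"
    and t0: "t0 \<in> borel_measurable N"
    and max: "AE \<omega> in N. maximizers (apply_bcontfun (f \<omega>)) = {t0 \<omega>}"
    and T: "\<And>n. T n \<in> borel_measurable (M n)"
    and maxT: "\<And>n. AE \<omega> in M n. T n \<omega> \<in> maximizers (apply_bcontfun (F n \<omega>))"
    and a: "(\<integral>\<omega>. apply_bcontfun h (t0 \<omega>) \<partial>N) < a"
  shows "\<forall>\<^sub>F n in sequentially. (\<integral>\<omega>. apply_bcontfun h (T n \<omega>) \<partial>M n) < a"
proof -
  interpret N: prob_space N by (rule N)
  \<comment> \<open>Continuity and the bound \<open>norm h\<close> make the penalized supremum an
    admissible test function on \<open>C(K)\<close>.\<close>
  define H :: "nat \<Rightarrow> ('a \<Rightarrow>\<^sub>C real) \<Rightarrow>\<^sub>C real" where "H k = Bcontfun (penalized_sup h (real k))" for k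
  have H: "apply_bcontfun (H k) g = penalized_sup h (real k) g" for k g
    unfolding H_def
    by (subst Bcontfun_inverse)
       (auto intro!: bcontfun_normI[of _ "norm h"] continuous_on_penalized_sup abs_penalized_sup_le)
  have "(\<lambda>k. \<integral>\<omega>. apply_bcontfun (H k) (f \<omega>) \<partial>N) \<longlonglongrightarrow> (\<integral>\<omega>. apply_bcontfun h (t0 \<omega>) \<partial>N)"
  proof (rule integral_dominated_convergence[where w = "\<lambda>_. norm h"])
    show "AE \<omega> in N. (\<lambda>k. apply_bcontfun (H k) (f \<omega>)) \<longlonglongrightarrow> apply_bcontfun h (t0 \<omega>)"
      using max by eventually_elim (unfold H, rule penalized_sup_tendsto[OF comp])
    show "AE \<omega> in N. norm (apply_bcontfun (H k) (f \<omega>)) \<le> norm h" for k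
      by (simp add: H abs_penalized_sup_le)
  qed (intro measurable_apply_bcontfun t0 f integrable_const | simp)+
  \<comment> \<open>A single \<open>k\<close> is fixed before \<open>n\<close> varies, so weak
    convergence is applied to one test function only.\<close>
  from order_tendstoD(2)[OF this a]
  obtain k where k: "(\<integral>\<omega>. apply_bcontfun (H k) (f \<omega>) \<partial>N) < a"
    unfolding eventually_sequentially by blast
  have "(\<lambda>n. \<integral>\<omega>. apply_bcontfun (H k) (F n \<omega>) \<partial>M n) \<longlonglongrightarrow> (\<integral>\<omega>. apply_bcontfun (H k) (f \<omega>) \<partial>N)"
    using conv unfolding converges_in_distribution_def by blast
  then have "\<forall>\<^sub>F n in sequentially. (\<integral>\<omega>. apply_bcontfun (H k) (F n \<omega>) \<partial>M n) < a"
    using k by (rule order_tendstoD(2))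
  then show ?thesis
  proof eventually_elim
    case (elim n)
    have "(\<integral>\<omega>. apply_bcontfun h (T n \<omega>) \<partial>M n) \<le> (\<integral>\<omega>. apply_bcontfun (H k) (F n \<omega>) \<partial>M n)"
    proof (rule integral_mono_AE)
      show "AE \<omega> in M n. apply_bcontfun h (T n \<omega>) \<le> apply_bcontfun (H k) (F n \<omega>)"
        using maxT[of n] by eventually_elim (unfold H, rule penalized_sup_ge)
    qed (intro prob_space.integrable_apply_bcontfun M F T)+
    with elim show ?case
      by simp
  qed
qed

text \<open>The upper estimate for \<open>h\<close> and the one for \<open>- h\<close> enclose the
  limit of the expectations.\<close>

lemma argmax_converges_in_distribution:
  fixes F :: "nat \<Rightarrow> 'w \<Rightarrow> 'a::metric_space \<Rightarrow>\<^sub>C real" and f :: "'v \<Rightarrow> 'a \<Rightarrow>\<^sub>C real"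
  assumes comp: "compact (UNIV :: 'a set)"
    and "\<And>n. prob_space (M n)" and "prob_space N"
    and "\<And>n. F n \<in> borel_measurable (M n)" and "f \<in> borel_measurable N"
    and "converges_in_distribution M F N f"
    and "t0 \<in> borel_measurable N"
    and "AE \<omega> in N. maximizers (apply_bcontfun (f \<omega>)) = {t0 \<omega>}"
    and "\<And>n. T n \<in> borel_measurable (M n)"
    and "\<And>n. AE \<omega> in M n. T n \<omega> \<in> maximizers (apply_bcontfun (F n \<omega>))"
  shows "converges_in_distribution M T N t0"
  unfolding converges_in_distribution_def
proof (intro allI order_tendstoI)
  note upper = argmax_expectation_upper[OF assms]
  fix h :: "'a \<Rightarrow>\<^sub>C real" and a :: real
  show "\<forall>\<^sub>F n in sequentially. (\<integral>\<omega>. apply_bcontfun h (T n \<omega>) \<partial>M n) < a"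
    if "(\<integral>\<omega>. apply_bcontfun h (t0 \<omega>) \<partial>N) < a"
    using that by (rule upper)
  show "\<forall>\<^sub>F n in sequentially. a < (\<integral>\<omega>. apply_bcontfun h (T n \<omega>) \<partial>M n)"
    if "a < (\<integral>\<omega>. apply_bcontfun h (t0 \<omega>) \<partial>N)"
    using upper[of "- h" "- a"] that by simp
qed

text \<open>\<open>K\<close> is the whole type \<open>'a\<close>; by compactness its continuous real
  functions are bounded, so \<open>'a \<Rightarrow>\<^sub>C real\<close> is \<open>C(K)\<close>.
  Suprema in \<open>ereal\<close> give minus infinity on the empty set, and \<open>r\<close> is the
  \<open>o_p(1)\<close> term.\<close>

theorem lemma4p9:
  assumes "compact (UNIV :: 'a::metric_space set)"
  shows
    "(\<forall>(f :: 'a \<Rightarrow> real) t0. continuous_on UNIV f \<and> maximizers f = {t0} \<longrightarrow>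
        \<comment> \<open>(a)\<close>
        (\<forall>\<epsilon>>0. \<exists>\<delta>>0. (SUP t\<in>{t. dist t t0 \<ge> \<epsilon>}. ereal (f t)) \<le> ereal (f t0 - \<delta>)) \<and>
        (\<forall>\<epsilon>>0. \<forall>\<delta>>0. (SUP t\<in>{t. dist t t0 \<ge> \<epsilon>}. ereal (f t)) \<le> ereal (f t0 - \<delta>) \<longrightarrow>
           (\<forall>g. sup_norm (\<lambda>t. g t - f t) \<le> ereal (\<delta> / 3) \<longrightarrow>
              (\<forall>s \<in> maximizers g. dist s t0 < \<epsilon>))) \<and>
        \<comment> \<open>(b)\<close>
        (\<forall>(M :: nat \<Rightarrow> 'w measure) (F :: nat \<Rightarrow> 'w \<Rightarrow> 'a \<Rightarrow> real) (T :: nat \<Rightarrow> 'w \<Rightarrow> 'a)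
            (r :: nat \<Rightarrow> 'w \<Rightarrow> real).
           (\<forall>n. prob_space (M n)) \<and>
           vanishes_in_prob M (\<lambda>n \<omega>. sup_norm (\<lambda>t. F n \<omega> t - f t)) \<and>
           converges_in_prob M r 0 \<and>
           (\<forall>n. AE \<omega> in M n. ereal (F n \<omega> (T n \<omega>)) \<ge> (SUP t. ereal (F n \<omega> t)) - ereal (r n \<omega>))
           \<longrightarrow> converges_in_prob M T t0)) \<and>
     \<comment> \<open>(c)\<close>
     (\<forall>(M :: nat \<Rightarrow> 'w measure) (F :: nat \<Rightarrow> 'w \<Rightarrow> 'a \<Rightarrow>\<^sub>C real) (T :: nat \<Rightarrow> 'w \<Rightarrow> 'a)
         (N :: 'v measure) (f :: 'v \<Rightarrow> 'a \<Rightarrow>\<^sub>C real) (t0 :: 'v \<Rightarrow> 'a).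
        (\<forall>n. prob_space (M n)) \<and> prob_space N \<and>
        (\<forall>n. F n \<in> borel_measurable (M n)) \<and> f \<in> borel_measurable N \<and>
        converges_in_distribution M F N f \<and>
        t0 \<in> borel_measurable N \<and> (AE \<omega> in N. maximizers (apply_bcontfun (f \<omega>)) = {t0 \<omega>}) \<and>
        (\<forall>n. T n \<in> borel_measurable (M n)) \<and>
        (\<forall>n. AE \<omega> in M n. T n \<omega> \<in> maximizers (apply_bcontfun (F n \<omega>)))
        \<longrightarrow> converges_in_distribution M T N t0)"
proof (intro conjI allI impI ballI; (elim conjE)?)
  fix f :: "'a \<Rightarrow> real" and t0 :: 'a and \<epsilon> :: real
  assume "continuous_on UNIV f" "maximizers f = {t0}" "\<epsilon> > 0"
  then obtain \<delta> where "\<delta> > 0" "\<And>t. dist t t0 \<ge> \<epsilon> \<Longrightarrow> f t \<le> f t0 - \<delta>"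
    using well_separated_maximizer[OF assms] by blast
  then show "\<exists>\<delta>>0. (SUP t\<in>{t. dist t t0 \<ge> \<epsilon>}. ereal (f t)) \<le> ereal (f t0 - \<delta>)"
    by (auto simp: SUP_le_iff)
next
  fix f g :: "'a \<Rightarrow> real" and t0 s :: 'a and \<epsilon> \<delta> :: real
  assume "\<delta> > 0" and sep: "(SUP t\<in>{t. dist t t0 \<ge> \<epsilon>}. ereal (f t)) \<le> ereal (f t0 - \<delta>)"
    and near: "sup_norm (\<lambda>t. g t - f t) \<le> ereal (\<delta> / 3)" and "s \<in> maximizers g"
  \<comment> \<open>An exact maximizer has slack zero, which is below
    \<open>\<delta> / 3\<close>.\<close>
  then have "g s > g t0 - \<delta> / 3"
    unfolding mem_maximizers_iff by (smt (verit) divide_pos_pos)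
  with near show "dist s t0 < \<epsilon>"
    using sep by (intro near_maximizer_close[where f = f and g = g and \<delta> = \<delta>]) (auto simp: SUP_le_iff)
next
  fix f :: "'a \<Rightarrow> real" and t0 :: 'a and M :: "nat \<Rightarrow> 'w measure"
    and F :: "nat \<Rightarrow> 'w \<Rightarrow> 'a \<Rightarrow> real" and T :: "nat \<Rightarrow> 'w \<Rightarrow> 'a" and r :: "nat \<Rightarrow> 'w \<Rightarrow> real"
  assume "continuous_on UNIV f" "maximizers f = {t0}"
    "vanishes_in_prob M (\<lambda>n \<omega>. sup_norm (\<lambda>t. F n \<omega> t - f t))" "converges_in_prob M r 0"
    "\<forall>n. AE \<omega> in M n. ereal (F n \<omega> (T n \<omega>)) \<ge> (SUP t. ereal (F n \<omega> t)) - ereal (r n \<omega>)"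
  then show "converges_in_prob M T t0"
    by (intro approx_maximizers_converge_in_prob[OF assms]) auto
next
  fix M :: "nat \<Rightarrow> 'w measure" and F :: "nat \<Rightarrow> 'w \<Rightarrow> 'a \<Rightarrow>\<^sub>C real" and T :: "nat \<Rightarrow> 'w \<Rightarrow> 'a"
    and N :: "'v measure" and f :: "'v \<Rightarrow> 'a \<Rightarrow>\<^sub>C real" and t0 :: "'v \<Rightarrow> 'a"
  assume "\<forall>n. prob_space (M n)" "prob_space N" "\<forall>n. F n \<in> borel_measurable (M n)"
    "f \<in> borel_measurable N" "converges_in_distribution M F N f" "t0 \<in> borel_measurable N"
    "AE \<omega> in N. maximizers (apply_bcontfun (f \<omega>)) = {t0 \<omega>}"
    "\<forall>n. T n \<in> borel_measurable (M n)"
    "\<forall>n. AE \<omega> in M n. T n \<omega> \<in> maximizers (apply_bcontfun (F n \<omega>))"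
  then show "converges_in_distribution M T N t0"
    by (intro argmax_converges_in_distribution[OF assms]) auto
qed

end
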